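(* For any $\varepsilon>0$ and any $\delta>0$ sufficiently small depending on $\varepsilon$, there is a constant $C_{\varepsilon,\delta}>0$ such that for every $d\ge1$, every $(\varepsilon,\delta)$-differentially private algorithm for tree aggregation on the complete binary tree of depth $d$ has $\mathsf{mRMSE}$ (i.e. $0$-$\mathsf{mRMSE}$) at least $C_{\varepsilon,\delta}\cdot\sqrt d$.
   Context: Tree aggregation: $\mathcal{T}$ is a rooted tree whose structure is known in advance; its depth $d$ is the maximum number of nodes on a root-to-leaf path. The input is a vector $x\in\mathbb{N}^{\mathsf{leaves}(\mathcal{T})}$ of non-negative integers; each node $u$ has weight $w_u=\sum_{v \text{ a leaf under } u} x_v$ (a leaf is under itself). An algorithm outputs a randomized estimate $\tilde w\in\mathbb{R}^{\mathsf{nodes}(\mathcal{T})}$ of $w$. A randomized algorithm $\mathcal{A}$ is $(\varepsilon,\delta)$-differentially private if $\Pr[\mathcal{A}(x)\in S]\le e^\varepsilon\Pr[\mathcal{A}(x')\in S]+\delta$ for every measurable $S$ and all inputs $x,x'$ with $\|x-x'\|_1=1$. The $\mathsf{mRMSE}$ of an algorithm $\mathcal{M}$ is $\max_{x}\max_{u\in\mathsf{nodes}(\mathcal{T})}\sqrt{\mathbb{E}[(\mathcal{M}(x)_u-w_u)^2]}$, the maximum over all inputs $x$. *)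

theory Defs
  imports "HOL-Probability.Probability" "HOL-Library.Sublist"
begin

text \<open>A rooted tree is represented by the set of addresses of its nodes: the root is the
  empty list and the children of \<open>u\<close> are the addresses \<open>u @ [a]\<close> that belong to the set.\<close>

definition rooted_tree :: "'a list set \<Rightarrow> bool" where
  "rooted_tree T \<longleftrightarrow> finite T \<and> T \<noteq> {} \<and> (\<forall>v\<in>T. \<forall>u. prefix u v \<longrightarrow> u \<in> T)"

definition leaves :: "'a list set \<Rightarrow> 'a list set" where
  "leaves T = {v \<in> T. \<forall>a. v @ [a] \<notin> T}"

text \<open>The root-to-leaf path ending in the leaf \<open>v\<close> consists of \<open>length v + 1\<close> nodes.\<close>

definition depth :: "'a list set \<Rightarrow> nat" where
  "depth T = Max ((\<lambda>v. length v + 1) ` leaves T)"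

definition complete_binary_tree :: "nat \<Rightarrow> bool list set" where
  "complete_binary_tree d = {u. length u < d}"

definition inputs :: "'a list set \<Rightarrow> ('a list \<Rightarrow> nat) set" where
  "inputs T = leaves T \<rightarrow>\<^sub>E UNIV"

definition weight :: "'a list set \<Rightarrow> ('a list \<Rightarrow> nat) \<Rightarrow> 'a list \<Rightarrow> nat" where
  "weight T x u = (\<Sum>v | v \<in> leaves T \<and> prefix u v. x v)"

definition l1_dist :: "'a list set \<Rightarrow> ('a list \<Rightarrow> nat) \<Rightarrow> ('a list \<Rightarrow> nat) \<Rightarrow> int" where
  "l1_dist T x y = (\<Sum>v\<in>leaves T. \<bar>int (x v) - int (y v)\<bar>)"

text \<open>A randomized algorithm is given by the distribution of its output on each input. No
  measurability in the input is needed, as there are only countably many inputs.\<close>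

definition tree_aggregation_algorithm ::
    "'a list set \<Rightarrow> (('a list \<Rightarrow> nat) \<Rightarrow> ('a list \<Rightarrow> real) measure) \<Rightarrow> bool" where
  "tree_aggregation_algorithm T A \<longleftrightarrow>
     (\<forall>x\<in>inputs T. prob_space (A x) \<and> sets (A x) = sets (\<Pi>\<^sub>M u\<in>T. (borel :: real measure)))"

definition differentially_private ::
    "real \<Rightarrow> real \<Rightarrow> 'a list set \<Rightarrow> (('a list \<Rightarrow> nat) \<Rightarrow> ('a list \<Rightarrow> real) measure) \<Rightarrow> bool" where
  "differentially_private \<epsilon> \<delta> T A \<longleftrightarrow>
     (\<forall>x\<in>inputs T. \<forall>x'\<in>inputs T. l1_dist T x x' = 1 \<longrightarrow>
        (\<forall>S\<in>sets (\<Pi>\<^sub>M u\<in>T. (borel :: real measure)).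
           measure (A x) S \<le> exp \<epsilon> * measure (A x') S + \<delta>))"

definition ennreal_sqrt :: "ennreal \<Rightarrow> ennreal" where
  "ennreal_sqrt a = (if a = \<infinity> then \<infinity> else ennreal (sqrt (enn2real a)))"

text \<open>The value is extended, since the mean squared error may be infinite for some input and
  may be unbounded over the infinitely many inputs.\<close>

definition mRMSE ::
    "'a list set \<Rightarrow> (('a list \<Rightarrow> nat) \<Rightarrow> ('a list \<Rightarrow> real) measure) \<Rightarrow> ennreal" where
  "mRMSE T A = (SUP x\<in>inputs T. SUP u\<in>T.
     ennreal_sqrt (\<integral>\<^sup>+ w. ennreal ((w u - real (weight T x u))\<^sup>2) \<partial>A x))"

lemma rooted_tree_complete_binary_tree:
  assumes "d \<ge> 1"
  shows "rooted_tree (complete_binary_tree d)"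
proof -
  have "finite (complete_binary_tree d)"
  proof (rule finite_subset)
    show "complete_binary_tree d \<subseteq> {u. set u \<subseteq> UNIV \<and> length u \<le> d}"
      by (auto simp: complete_binary_tree_def)
  qed (rule finite_lists_length_le, simp)
  moreover have "[] \<in> complete_binary_tree d"
    using assms by (simp add: complete_binary_tree_def)
  moreover have "u \<in> complete_binary_tree d" if "v \<in> complete_binary_tree d" "prefix u v" for u v
    using that by (auto simp: complete_binary_tree_def dest: prefix_length_le)
  ultimately show ?thesis
    unfolding rooted_tree_def by blast
qed

lemma leaves_complete_binary_tree:
  assumes "d \<ge> 1"
  shows "leaves (complete_binary_tree d) = {v. length v = d - 1}"
  using assms by (auto simp: leaves_def complete_binary_tree_def)

lemma depth_complete_binary_tree:
  assumes "d \<ge> 1"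
  shows "depth (complete_binary_tree d) = d"
proof -
  have "replicate (d - 1) True \<in> leaves (complete_binary_tree d)"
    using assms by (simp add: leaves_complete_binary_tree)
  then have "leaves (complete_binary_tree d) \<noteq> {}"
    by blast
  moreover have "length v + 1 = d" if "v \<in> leaves (complete_binary_tree d)" for v
    using that assms by (simp add: leaves_complete_binary_tree)
  ultimately have "(\<lambda>v. length v + 1) ` leaves (complete_binary_tree d) = {d}"
    by blast
  then show ?thesis
    by (simp add: depth_def)
qed

end

theory Submission
  imports Defs
begin

text \<open>Restrict to inputs in \<open>{0,1}\<close> at the leaves. For a leaf \<open>v\<close>, consider the linear functional that
  adds the root value to the differences between each node of the path to \<open>v\<close> and its sibling.
  Flipping the input at \<open>v\<close> changes the functional of the true weights by exactly \<open>\<plusminus>d\<close>, so privacy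
  and Chebyshev's inequality force its mean squared error, averaged over the two inputs, to be of
  order \<open>d\<^sup>2\<close>. For a uniformly random leaf \<open>v\<close> and fixed node errors, however, the functional of the
  errors is a martingale along the path, so its mean square is at most of order \<open>d\<close> times the
  largest mean squared error of a node. The flip is a bijection of the cube, so averaging
  over all inputs and leaves lets the two bounds be compared.\<close>

section \<open>Signed sums along a path\<close>

definition signed_path_sum :: "(bool list \<Rightarrow> real) \<Rightarrow> bool list \<Rightarrow> real" where
  "signed_path_sum z v =
     z [] + (\<Sum>k<length v. z (take (Suc k) v) - z (take k v @ [\<not> v ! k]))"

lemma signed_path_sum_Nil [simp]: "signed_path_sum z [] = z []"
  by (simp add: signed_path_sum_def)

text \<open>The recursion behind the inductions below: the increment at a child of \<open>v\<close>
  is the negative of the one at its sibling, which is the martingale property.\<close>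

lemma signed_path_sum_snoc [simp]:
  "signed_path_sum z (v @ [b]) = signed_path_sum z v + (z (v @ [b]) - z (v @ [\<not> b]))"
  by (simp add: signed_path_sum_def nth_append)

lemma signed_path_sum_diff:
  "signed_path_sum (\<lambda>u. z u - y u) v = signed_path_sum z v - signed_path_sum y v"
  by (induction v rule: rev_induct) auto

lemma signed_path_sum_add_scaled:
  "signed_path_sum (\<lambda>u. z u + c * y u) v = signed_path_sum z v + c * signed_path_sum y v"
  by (induction v rule: rev_induct) (auto simp: algebra_simps)

text \<open>The root and each further node of the path contribute 1, while every sibling leaves the
  path and contributes 0. The endpoint \<open>v'\<close> is kept apart from \<open>v\<close> so that
  the induction can shorten \<open>v\<close> under a fixed indicator.\<close>

lemma signed_path_sum_prefix_indicator:
  "prefix v v' \<Longrightarrow> signed_path_sum (\<lambda>u. of_bool (prefix u v')) v = real (length v) + 1"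
proof (induction v rule: rev_induct)
  case (snoc b v)
  have "\<not> prefix (v @ [\<not> b]) v'"
    using snoc.prems by (auto simp: prefix_def)
  moreover have "prefix v v'"
    using snoc.prems by (rule append_prefixD)
  ultimately show ?case
    using snoc by simp
qed simp

lemma sum_lists_length_Suc:
  fixes f :: "bool list \<Rightarrow> 'a :: comm_monoid_add"
  shows "(\<Sum>v | length v = Suc n. f v) = (\<Sum>v | length v = n. f (v @ [True]) + f (v @ [False]))"
proof -
  have "(\<Sum>v | length v = Suc n. f v) = (\<Sum>(v, b)\<in>{v. length v = n} \<times> UNIV. f (v @ [b]))"
    by (rule sum.reindex_bij_witness[where i = "\<lambda>(v, b). v @ [b]" and j = "\<lambda>v. (butlast v, last v)"])
       (auto simp: append_butlast_last_id length_Suc_conv_rev)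
  also have "\<dots> = (\<Sum>v | length v = n. \<Sum>b\<in>UNIV. f (v @ [b]))"
    by (simp add: sum.cartesian_product)
  finally show ?thesis
    by (simp add: UNIV_bool add.commute)
qed

lemma card_bool_lists_length: "card {v :: bool list. length v = n} = 2 ^ n"
  using card_lists_length_eq[of "UNIV :: bool set" n] by simp

lemma finite_bool_lists_length: "finite {v :: bool list. length v = n}"
  using finite_lists_length_eq[of "UNIV :: bool set" n] by simp

text \<open>The cross terms cancel because the two children of a node contribute opposite increments.\<close>

lemma sum_signed_path_sum_square_le:
  "(\<Sum>v | length v = n. (signed_path_sum z v)\<^sup>2)
     \<le> 4 * (\<Sum>k\<le>n. 2 ^ (n - k) * (\<Sum>u | length u = k. (z u)\<^sup>2))"
proof (induction n)
  case (Suc n)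
  let ?S = "\<lambda>k. \<Sum>u | length u = k. (z u)\<^sup>2"
  \<comment> \<open>The right side exceeds the left by \<open>2 * (a + b)\<^sup>2\<close>.\<close>
  have pair: "(s + (a - b))\<^sup>2 + (s + (b - a))\<^sup>2 \<le> 2 * s\<^sup>2 + 4 * (a\<^sup>2 + b\<^sup>2)" for s a b :: real
    using zero_le_power2[of "a + b"] by (simp add: power2_eq_square algebra_simps)
  have "(\<Sum>v | length v = Suc n. (signed_path_sum z v)\<^sup>2)
      \<le> (\<Sum>v | length v = n. 2 * (signed_path_sum z v)\<^sup>2 + 4 * ((z (v @ [True]))\<^sup>2 + (z (v @ [False]))\<^sup>2))"
    unfolding sum_lists_length_Suc by (intro sum_mono) (use pair in auto)
  also have "\<dots> = 2 * (\<Sum>v | length v = n. (signed_path_sum z v)\<^sup>2) + 4 * ?S (Suc n)"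
    unfolding sum_lists_length_Suc by (simp add: sum.distrib sum_distrib_left)
  also have "\<dots> \<le> 2 * (4 * (\<Sum>k\<le>n. 2 ^ (n - k) * ?S k)) + 4 * ?S (Suc n)"
    using Suc by simp
  also have "\<dots> = 4 * (\<Sum>k\<le>Suc n. 2 ^ (Suc n - k) * ?S k)"
    by (simp add: sum_distrib_left Suc_diff_le mult_ac)
  finally show ?case .
qed simp

text \<open>The signed change is taken in the reals, so that the new weights have the shape required
  by \<open>signed_path_sum_add_scaled\<close>.\<close>

lemma weight_fun_upd:
  assumes "finite (leaves T)" "v \<in> leaves T"
  shows "real (weight T (x(v := k)) u) = real (weight T x u) + (real k - real (x v)) * of_bool (prefix u v)"
proof (cases "prefix u v")
  case True
  let ?L = "{w. w \<in> leaves T \<and> prefix u w}"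
  have "v \<in> ?L" "finite ?L"
    using assms True by auto
  then show ?thesis
    using True unfolding weight_def by (simp add: sum.remove[of ?L v])
next
  case False
  then have "weight T (x(v := k)) u = weight T x u"
    unfolding weight_def by (intro sum.cong) auto
  then show ?thesis
    using False by simp
qed

section \<open>Privacy at two neighbouring inputs\<close>

text \<open>If both errors were small, Chebyshev's inequality would make closeness of
  \<open>f\<close> to \<open>a\<close> likely under \<open>M\<close> and, as \<open>b\<close> is far
  from \<open>a\<close>, unlikely under \<open>N\<close>. Privacy forbids such a gap.\<close>

lemma two_point_lower_bound:
  fixes f :: "'a \<Rightarrow> real"
  assumes "prob_space M" "prob_space N" and sets: "sets N = sets M"
    and f [measurable]: "f \<in> borel_measurable M"
    and int: "integrable M (\<lambda>w. (f w - a)\<^sup>2)" "integrable N (\<lambda>w. (f w - b)\<^sup>2)"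
    and D: "D > 0" "\<bar>a - b\<bar> \<ge> D"
    and close: "\<And>S. S \<in> sets M \<Longrightarrow> measure M S \<le> exp \<epsilon> * measure N S + \<delta>"
  shows "(1 - \<delta>) * D\<^sup>2 / 4 \<le> (\<integral>w. (f w - a)\<^sup>2 \<partial>M) + exp \<epsilon> * (\<integral>w. (f w - b)\<^sup>2 \<partial>N)"
proof -
  interpret M: prob_space M by fact
  interpret N: prob_space N by fact
  have fN [measurable]: "f \<in> borel_measurable N"
    using f sets by (simp cong: measurable_cong_sets)
  have space: "space N = space M"
    using sets by (rule sets_eq_imp_space_eq)
  define S where "S = {w \<in> space M. \<bar>f w - a\<bar> < D / 2}"
  have S: "S \<in> sets M"
    unfolding S_def by measurable
  have "M.prob (space M - S) \<le> M.prob {w \<in> space M. D / 2 \<le> \<bar>f w - a\<bar>}"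
    by (intro M.finite_measure_mono) (auto simp: S_def)
  also have "\<dots> \<le> (\<integral>w. (f w - a)\<^sup>2 \<partial>M) / (D / 2)\<^sup>2"
    using D int by (intro M.second_moment_method) auto
  finally have M_bound: "1 - M.prob S \<le> 4 * (\<integral>w. (f w - a)\<^sup>2 \<partial>M) / D\<^sup>2"
    using S by (simp add: M.prob_compl power_divide mult.commute)
  have "N.prob S \<le> N.prob {w \<in> space N. D / 2 \<le> \<bar>f w - b\<bar>}"
  proof (rule N.finite_measure_mono)
    have "D / 2 \<le> \<bar>f w - b\<bar>" if "\<bar>f w - a\<bar> < D / 2" for w
      using that D by linarith
    then show "S \<subseteq> {w \<in> space N. D / 2 \<le> \<bar>f w - b\<bar>}"
      by (auto simp: S_def space)
  qed measurable
  also have "\<dots> \<le> (\<integral>w. (f w - b)\<^sup>2 \<partial>N) / (D / 2)\<^sup>2"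
    using D int by (intro N.second_moment_method) auto
  finally have "N.prob S \<le> 4 * (\<integral>w. (f w - b)\<^sup>2 \<partial>N) / D\<^sup>2"
    by (simp add: power_divide mult.commute)
  then have "exp \<epsilon> * N.prob S \<le> exp \<epsilon> * (4 * (\<integral>w. (f w - b)\<^sup>2 \<partial>N) / D\<^sup>2)"
    by (rule mult_left_mono) simp
  with M_bound close[OF S]
  have "1 - \<delta> \<le> 4 * (\<integral>w. (f w - a)\<^sup>2 \<partial>M) / D\<^sup>2 + exp \<epsilon> * (4 * (\<integral>w. (f w - b)\<^sup>2 \<partial>N) / D\<^sup>2)"
    by linarith
  also have "\<dots> = ((\<integral>w. (f w - a)\<^sup>2 \<partial>M) + exp \<epsilon> * (\<integral>w. (f w - b)\<^sup>2 \<partial>N)) * 4 / D\<^sup>2"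
    by (simp add: algebra_simps add_divide_distrib)
  finally show ?thesis
    using D by (simp add: field_simps)
qed

lemma measurable_signed_path_sum:
  assumes "length v < d"
  shows "(\<lambda>w. signed_path_sum w v) \<in> borel_measurable (\<Pi>\<^sub>M u\<in>complete_binary_tree d. borel)"
  unfolding signed_path_sum_def using assms
  by (intro borel_measurable_add borel_measurable_sum borel_measurable_diff measurable_component_singleton)
     (auto simp: complete_binary_tree_def)

section \<open>Averaging over inputs and leaves\<close>

text \<open>Double counting over pairs of a 0-1 input and a leaf: privacy gives order
  \<open>d\<^sup>2\<close> per pair, the martingale bound at most order \<open>d * B\<close> per
  pair on average. One factor \<open>d\<close> survives.\<close>

lemma mean_square_error_lower_bound:
  assumes d: "d \<ge> 1"
    and alg: "tree_aggregation_algorithm (complete_binary_tree d) A"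
    and dp: "differentially_private \<epsilon> \<delta> (complete_binary_tree d) A"
    and int: "\<And>x u. x \<in> inputs (complete_binary_tree d) \<Longrightarrow> u \<in> complete_binary_tree d \<Longrightarrow>
      integrable (A x) (\<lambda>w. (w u - real (weight (complete_binary_tree d) x u))\<^sup>2)"
    and bound: "\<And>x u. x \<in> inputs (complete_binary_tree d) \<Longrightarrow> u \<in> complete_binary_tree d \<Longrightarrow>
      (\<integral>w. (w u - real (weight (complete_binary_tree d) x u))\<^sup>2 \<partial>A x) \<le> B"
  shows "(1 - \<delta>) * real d \<le> 16 * (1 + exp \<epsilon>) * B"
proof -
  define T where "T = complete_binary_tree d"
  \<comment> \<open>Depth counts nodes, so leaf addresses have length \<open>d - 1\<close>.\<close>
  define n where "n = d - 1"
  have dn: "real d = real n + 1"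
    using d by (simp add: n_def)
  have T: "u \<in> T \<longleftrightarrow> length u \<le> n" for u
    using d by (auto simp: T_def n_def complete_binary_tree_def)
  define L where "L = {v :: bool list. length v = n}"
  have leaves: "leaves T = L"
    using d by (simp add: T_def n_def L_def leaves_complete_binary_tree)
  have finL: "finite L" and cardL: "card L = 2 ^ n"
    by (simp_all add: L_def finite_bool_lists_length card_bool_lists_length)
  define X where "X = L \<rightarrow>\<^sub>E {0, 1 :: nat}"
  have finX: "finite X"
    unfolding X_def using finL by (intro finite_PiE) auto
  have "(\<lambda>v\<in>L. 0) \<in> X"
    by (simp add: X_def)
  then have cardX: "card X > 0"
    using finX by (auto simp: card_gt_0_iff)
  have X_inputs: "x \<in> inputs T" if "x \<in> X" for x
    using that by (auto simp: X_def inputs_def leaves PiE_def)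
  \<comment> \<open>On values 0 and 1 the truncated subtraction is exact and an involution.\<close>
  define flip where "flip x v = x(v := 1 - x v)" for x :: "bool list \<Rightarrow> nat" and v
  have flip_X: "flip x v \<in> X" if "x \<in> X" "v \<in> L" for x v
    using that by (auto simp: X_def flip_def PiE_iff extensional_def)
  have X01: "x v = 0 \<or> x v = 1" if "x \<in> X" "v \<in> L" for x v
    using that by (auto simp: X_def)
  have flip_flip: "flip (flip x v) v = x" if "x \<in> X" "v \<in> L" for x v
    using X01[OF that] by (auto simp: flip_def)
  define err where "err x w u = w u - real (weight T x u)" for x w u
  define m where "m x v = (\<integral>w. (signed_path_sum (err x w) v)\<^sup>2 \<partial>A x)" for x v
  note int' = int[folded T_def, folded err_def] and bound' = bound[folded T_def, folded err_def]
  have prob: "prob_space (A x)" and sets: "sets (A x) = sets (\<Pi>\<^sub>M u\<in>T. borel)" if "x \<in> X" for x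
    using alg X_inputs[OF that] by (auto simp: tree_aggregation_algorithm_def T_def)
  have meas: "(\<lambda>w. signed_path_sum w v) \<in> borel_measurable (A x)" if "x \<in> X" "v \<in> L" for x v
    using measurable_signed_path_sum[of v d] sets[OF that(1)] that d
    by (auto simp: L_def T_def n_def cong: measurable_cong_sets)
  have err_eq: "signed_path_sum (err x w) v
      = signed_path_sum w v - signed_path_sum (\<lambda>u. real (weight T x u)) v" for x w v
    unfolding err_def by (rule signed_path_sum_diff)

  \<comment> \<open>This pointwise bound on the sum over all leaves is a finite combination of
    squared node errors, so it is also an integrable majorant for each single leaf.\<close>
  define R where "R z = 4 * (\<Sum>k\<le>n. 2 ^ (n - k) * (\<Sum>u | length u = k. (z u)\<^sup>2))"
    for z :: "bool list \<Rightarrow> real"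
  have R_int: "integrable (A x) (\<lambda>w. R (err x w))" if "x \<in> X" for x
    unfolding R_def using that
    by (intro integrable_mult_right Bochner_Integration.integrable_sum int' X_inputs) (auto simp: T)
  have F_int: "integrable (A x) (\<lambda>w. (signed_path_sum (err x w) v)\<^sup>2)" if "x \<in> X" "v \<in> L" for x v
  proof (rule Bochner_Integration.integrable_bound[OF R_int[OF that(1)]])
    show "(\<lambda>w. (signed_path_sum (err x w) v)\<^sup>2) \<in> borel_measurable (A x)"
      unfolding err_eq using meas[OF that] by measurable
    have "(signed_path_sum z v)\<^sup>2 \<le> R z" for z
    proof -
      have "(signed_path_sum z v)\<^sup>2 \<le> (\<Sum>v\<in>L. (signed_path_sum z v)\<^sup>2)"
        using that(2) finL by (intro member_le_sum) auto
      then show ?thesis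
        using sum_signed_path_sum_square_le[of z n] by (simp add: R_def L_def)
    qed
    then show "AE w in A x. norm ((signed_path_sum (err x w) v)\<^sup>2) \<le> norm (R (err x w))"
      by (intro AE_I2) (simp add: order_trans[OF _ abs_ge_self])
  qed
  have upper: "(\<Sum>v\<in>L. m x v) \<le> 4 * 2 ^ n * real d * B" if x: "x \<in> X" for x
  proof -
    have "(\<Sum>v\<in>L. m x v) = (\<integral>w. (\<Sum>v\<in>L. (signed_path_sum (err x w) v)\<^sup>2) \<partial>A x)"
      unfolding m_def using F_int x by (simp add: Bochner_Integration.integral_sum)
    also have "\<dots> \<le> (\<integral>w. R (err x w) \<partial>A x)"
      using F_int x R_int[OF x] sum_signed_path_sum_square_le[where n = n]
      by (intro integral_mono Bochner_Integration.integrable_sum) (auto simp: R_def L_def)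
    also have "\<dots> = 4 * (\<Sum>k\<le>n. 2 ^ (n - k) * (\<Sum>u | length u = k. \<integral>w. (err x w u)\<^sup>2 \<partial>A x))"
    proof -
      have "integrable (A x) (\<lambda>w. (err x w u)\<^sup>2)" if "length u \<le> n" for u
        using that x by (intro int' X_inputs) (auto simp: T)
      then show ?thesis
        unfolding R_def by (subst integral_mult_right_zero, subst Bochner_Integration.integral_sum)
          (auto simp: Bochner_Integration.integral_sum)
    qed
    also have "\<dots> \<le> 4 * (\<Sum>k\<le>n. 2 ^ (n - k) * (\<Sum>u :: bool list | length u = k. B))"
      using x by (intro mult_left_mono sum_mono bound' X_inputs) (auto simp: T)
    \<comment> \<open>Level \<open>k\<close> has \<open>2 ^ k\<close> nodes, so each of the
      \<open>d\<close> levels contributes \<open>2 ^ n * B\<close>.\<close>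
    also have "\<dots> = 4 * (\<Sum>k\<le>n. 2 ^ n * B)"
      by (rule arg_cong[where f = "(*) 4"], rule sum.cong)
         (simp_all add: card_bool_lists_length mult.assoc[symmetric] power_add[symmetric])
    also have "\<dots> = 4 * 2 ^ n * real d * B"
      by (simp add: dn algebra_simps)
    finally show ?thesis .
  qed
  have lower: "(1 - \<delta>) * (real d)\<^sup>2 / 4 \<le> m x v + exp \<epsilon> * m (flip x v) v"
    if x: "x \<in> X" and v: "v \<in> L" for x v
    unfolding m_def err_eq
  proof (rule two_point_lower_bound)
    note y = flip_X[OF x v]
    show "prob_space (A x)" "prob_space (A (flip x v))"
      using prob x y by auto
    show "sets (A (flip x v)) = sets (A x)"
      using sets x y by simp
    show "(\<lambda>w. signed_path_sum w v) \<in> borel_measurable (A x)"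
      using x v by (rule meas)
    show "integrable (A x)
        (\<lambda>w. (signed_path_sum w v - signed_path_sum (\<lambda>u. real (weight T x u)) v)\<^sup>2)"
      using F_int[OF x v] by (simp add: err_eq)
    show "integrable (A (flip x v))
        (\<lambda>w. (signed_path_sum w v - signed_path_sum (\<lambda>u. real (weight T (flip x v) u)) v)\<^sup>2)"
      using F_int[OF y v] by (simp add: err_eq)
    show "real d > 0"
      using d by simp
    \<comment> \<open>The flip adds plus or minus the indicator of the path to \<open>v\<close>, on
      which the functional takes the value \<open>n + 1 = d\<close>.\<close>
    have "signed_path_sum (\<lambda>u. real (weight T (flip x v) u)) v
        = signed_path_sum (\<lambda>u. real (weight T x u)) v + (real (1 - x v) - real (x v)) * real d"
      using v finL unfolding flip_def
      by (simp add: weight_fun_upd leaves signed_path_sum_add_scaled signed_path_sum_prefix_indicator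
            dn L_def)
    then show "real d \<le> \<bar>signed_path_sum (\<lambda>u. real (weight T x u)) v
        - signed_path_sum (\<lambda>u. real (weight T (flip x v) u)) v\<bar>"
      using X01[OF x v] by auto
    have "l1_dist T x (flip x v) = (\<Sum>w\<in>L. of_bool (w = v))"
      unfolding l1_dist_def leaves using X01[OF x v] by (intro sum.cong) (auto simp: flip_def)
    also have "\<dots> = 1"
      using v finL by (simp add: of_bool_def)
    finally show "measure (A x) S \<le> exp \<epsilon> * measure (A (flip x v)) S + \<delta>" if "S \<in> sets (A x)" for S
      using dp that X_inputs x y sets[OF x] by (auto simp: differentially_private_def T_def)
  qed
  \<comment> \<open>For a fixed leaf the flip permutes the cube, so both terms of
    \<open>lower\<close> have the same sum over \<open>X\<close>; hence the factor
    \<open>1 + exp \<epsilon>\<close>.\<close>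
  have flip_sum: "(\<Sum>x\<in>X. m (flip x v) v) = (\<Sum>x\<in>X. m x v)" if "v \<in> L" for v
    by (rule sum.reindex_bij_witness[where i = "\<lambda>x. flip x v" and j = "\<lambda>x. flip x v"])
       (use that flip_X flip_flip in auto)
  have "real (card X) * 2 ^ n * ((1 - \<delta>) * (real d)\<^sup>2 / 4) = (\<Sum>v\<in>L. \<Sum>x\<in>X. (1 - \<delta>) * (real d)\<^sup>2 / 4)"
    by (simp add: cardL)
  also have "\<dots> \<le> (\<Sum>v\<in>L. \<Sum>x\<in>X. m x v + exp \<epsilon> * m (flip x v) v)"
    by (intro sum_mono lower)
  also have "\<dots> = (1 + exp \<epsilon>) * (\<Sum>v\<in>L. \<Sum>x\<in>X. m x v)"
    by (simp add: sum.distrib flip_sum sum_distrib_left[symmetric] algebra_simps)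
  \<comment> \<open>The flip argument fixes the leaf, whereas \<open>upper\<close> fixes the
    input.\<close>
  also have "\<dots> = (1 + exp \<epsilon>) * (\<Sum>x\<in>X. \<Sum>v\<in>L. m x v)"
    by (subst sum.swap) simp
  also have "\<dots> \<le> (1 + exp \<epsilon>) * (\<Sum>x\<in>X. 4 * 2 ^ n * real d * B)"
    by (intro mult_left_mono sum_mono upper) (auto intro: add_nonneg_nonneg)
  also have "\<dots> = real (card X) * 2 ^ n * ((1 + exp \<epsilon>) * (4 * real d * B))"
    by simp
  finally have "(1 - \<delta>) * (real d)\<^sup>2 / 4 \<le> (1 + exp \<epsilon>) * (4 * real d * B)"
    using cardX by (subst (asm) mult_le_cancel_left_pos) auto
  then have "real d * ((1 - \<delta>) * real d) \<le> real d * (16 * (1 + exp \<epsilon>) * B)"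
    by (simp add: power2_eq_square algebra_simps)
  then show ?thesis
    using d by (subst (asm) mult_le_cancel_left_pos) auto
qed

section \<open>From mean squared errors to mRMSE\<close>

lemma ennreal_sqrt_le_iff:
  assumes "r \<ge> 0"
  shows "ennreal_sqrt a \<le> ennreal r \<longleftrightarrow> a \<le> ennreal (r\<^sup>2)"
proof (cases a)
  case (real s)
  then show ?thesis
    using assms by (simp add: ennreal_sqrt_def real_sqrt_le_iff' ennreal_le_iff)
qed (use assms in \<open>simp add: ennreal_sqrt_def top_unique\<close>)

lemma mRMSE_le_iff:
  assumes "r \<ge> 0"
  shows "mRMSE T A \<le> ennreal r \<longleftrightarrow>
    (\<forall>x\<in>inputs T. \<forall>u\<in>T. (\<integral>\<^sup>+ w. ennreal ((w u - real (weight T x u))\<^sup>2) \<partial>A x) \<le> ennreal (r\<^sup>2))"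
  unfolding mRMSE_def by (simp add: SUP_le_iff ennreal_sqrt_le_iff[OF assms])

lemma mRMSE_square_lower_bound:
  assumes d: "d \<ge> 1"
    and alg: "tree_aggregation_algorithm (complete_binary_tree d) A"
    and dp: "differentially_private \<epsilon> \<delta> (complete_binary_tree d) A"
    and r: "r \<ge> 0" "mRMSE (complete_binary_tree d) A \<le> ennreal r"
  shows "(1 - \<delta>) * real d \<le> 16 * (1 + exp \<epsilon>) * r\<^sup>2"
proof (rule mean_square_error_lower_bound[OF d alg dp])
  let ?T = "complete_binary_tree d"
  fix x u
  assume x: "x \<in> inputs ?T" and u: "u \<in> ?T"
  let ?f = "\<lambda>w. (w u - real (weight ?T x u))\<^sup>2"
  have sets: "sets (A x) = sets (\<Pi>\<^sub>M u\<in>?T. borel)"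
    using alg x by (simp add: tree_aggregation_algorithm_def)
  have "(\<lambda>w. w u) \<in> borel_measurable (A x)"
    using measurable_component_singleton[OF u] sets by (simp cong: measurable_cong_sets)
  then have meas: "?f \<in> borel_measurable (A x)"
    by measurable
  have le: "(\<integral>\<^sup>+ w. ennreal (?f w) \<partial>A x) \<le> ennreal (r\<^sup>2)"
    using r x u by (simp add: mRMSE_le_iff)
  \<comment> \<open>A finite extended integral rules out the default value 0 that the Bochner
    integral takes on non-integrable functions.\<close>
  then show int: "integrable (A x) ?f"
    using meas by (intro integrableI_nonneg) (auto simp: order_le_less_trans)
  show "(\<integral>w. ?f w \<partial>A x) \<le> r\<^sup>2"
    using le nn_integral_eq_integral[OF int] by simp
qed

theorem theorem29:
  fixes \<epsilon> :: real
  assumes "\<epsilon> > 0"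
  shows "\<exists>\<delta>\<^sub>0 :: real. \<delta>\<^sub>0 > 0 \<and>
    (\<forall>\<delta>. 0 < \<delta> \<and> \<delta> \<le> \<delta>\<^sub>0 \<longrightarrow>
      (\<exists>C :: real. C > 0 \<and>
        (\<forall>d \<ge> 1. \<forall>A.
          tree_aggregation_algorithm (complete_binary_tree d) A \<and>
          differentially_private \<epsilon> \<delta> (complete_binary_tree d) A \<longrightarrow>
          mRMSE (complete_binary_tree d) A \<ge> ennreal (C * sqrt (real d)))))"
proof (rule exI[of _ "1/2"], intro conjI allI impI)
  fix \<delta> :: real
  assume \<delta>: "0 < \<delta> \<and> \<delta> \<le> 1 / 2"
  \<comment> \<open>Chosen so that the squared bound reads \<open>c * d \<le> r\<^sup>2\<close>; the
    threshold 1/2 on \<delta> serves to keep \<open>c\<close> positive.\<close>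
  define c where "c = (1 - \<delta>) / (16 * (1 + exp \<epsilon>))"
  have e: "1 + exp \<epsilon> > 0"
    by (simp add: add_pos_pos)
  then have c: "c > 0"
    using \<delta> by (simp add: c_def)
  show "\<exists>C :: real. C > 0 \<and>
        (\<forall>d \<ge> 1. \<forall>A.
          tree_aggregation_algorithm (complete_binary_tree d) A \<and>
          differentially_private \<epsilon> \<delta> (complete_binary_tree d) A \<longrightarrow>
          mRMSE (complete_binary_tree d) A \<ge> ennreal (C * sqrt (real d)))"
  proof (rule exI[of _ "sqrt c"], intro conjI allI impI)
    fix d :: nat and A
    assume d: "1 \<le> d"
      and A: "tree_aggregation_algorithm (complete_binary_tree d) A \<and>
        differentially_private \<epsilon> \<delta> (complete_binary_tree d) A"
    show "ennreal (sqrt c * sqrt (real d)) \<le> mRMSE (complete_binary_tree d) A"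
    \<comment> \<open>A finite value \<open>r\<close> serves as its own upper bound in
      \<open>mRMSE_square_lower_bound\<close>; an infinite one exceeds everything.\<close>
    proof (cases "mRMSE (complete_binary_tree d) A")
      case (real r)
      then have "(1 - \<delta>) * real d \<le> 16 * (1 + exp \<epsilon>) * r\<^sup>2"
        using d A by (intro mRMSE_square_lower_bound) auto
      then have "c * real d \<le> r\<^sup>2"
        using e by (simp add: c_def field_simps)
      then have "sqrt c * sqrt (real d) \<le> r"
        using real by (simp add: real_sqrt_mult[symmetric] real_le_lsqrt)
      then show ?thesis
        using real by (simp add: ennreal_leI)
    qed simp
  qed (use c in simp)
qed simp

end
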